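(* For each loss $\ell$ in the list (quadratic, absolute value, Huber), let $g$ be the corresponding nonconvex localization cost and $f$ its convex underestimator, $g^\star=\inf_x g(x)$, $f^\star=\min_x f(x)$, and let $x^\star$ be a minimizer of $f$. Let $\mathcal{E}_2$ be the set of edges $i\sim j$ with $\|x_i^\star-x_j^\star\|<d_{ij}$ and let $\mathcal{S}_2$ be the set of pairs $(i,k)$, $i\in\mathcal{V}$, $k\in\mathcal{A}_i$, with $\|x_i^\star-a_k\|<r_{ik}$. Then the optimality gap satisfies: (a) in the quadratic case, $$g_Q^\star-f_Q^\star\le\sum_{i\sim j\in\mathcal{E}_2}\tfrac12\big(\|x_i^\star-x_j^\star\|-d_{ij}\big)^2+\sum_{(i,k)\in\mathcal{S}_2}\tfrac12\big(\|x_i^\star-a_k\|-r_{ik}\big)^2;$$ (b) in the absolute value case, $$g_{|\cdot|}^\star-f_{|\cdot|}^\star\le\sum_{i\sim j\in\mathcal{E}_2}\tfrac12\big|\|x_i^\star-x_j^\star\|-d_{ij}\big|+\sum_{(i,k)\in\mathcal{S}_2}\tfrac12\big|\|x_i^\star-a_k\|-r_{ik}\big|;$$ (c) in the Huber case, $$g_R^\star-f_R^\star\le\sum_{i\sim j\in\mathcal{E}_2}\tfrac12h_{D_{ij}}\big(\|x_i^\star-x_j^\star\|-d_{ij}\big)+\sum_{(i,k)\in\mathcal{S}_2}\tfrac12h_{R_{ik}}\big(\|x_i^\star-a_k\|-r_{ik}\big).$$ (The minimizer $x^\star$, and hence $\mathcal{E}_2$ and $\mathcal{S}_2$, may differ among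 the three cases.)
   Context: Network: $\mathcal{G}=(\mathcal{V},\mathcal{E})$ is a finite undirected graph, $\mathcal{V}=\{1,\dots,n\}$, and $i\sim j$ denotes an edge. There is a finite set of anchors $\mathcal{A}=\{1,\dots,m\}$ with known positions $a_k\in\mathbb{R}^p$ ($p=2$ or $3$), and $\mathcal{A}_i\subset\mathcal{A}$ is the subset of anchors with a measured range to node $i$. Given data: range measurements $d_{ij}\ge0$ for $i\sim j$ and $r_{ik}\ge0$ for $i\in\mathcal{V}$, $k\in\mathcal{A}_i$; Huber radii $D_{ij}>0$, $R_{ik}>0$. The variable is $x=(x_i)_{i\in\mathcal{V}}$, $x_i\in\mathbb{R}^p$. Huber function: $h_\delta(s)=s^2$ if $|s|\le\delta$, $h_\delta(s)=2\delta|s|-\delta^2$ if $|s|\ge\delta$. Write $(s)_+=\max\{0,s\}$. The Huber costs are $$g_R(x)=\sum_{i\sim j}\tfrac12h_{D_{ij}}(\|x_i-x_j\|-d_{ij})+\sum_i\sum_{k\in\mathcal{A}_i}\tfrac12h_{R_{ik}}(\|x_i-a_k\|-r_{ik}),$$ $$f_R(x)=\sum_{i\sim j}\tfrac12h_{D_{ij}}\big((\|x_i-x_j\|-d_{ij})_+\big)+\sum_i\sum_{k\in\mathcal{A}_i}\tfrac12h_{R_{ik}}\big((\|x_i-a_k\|-r_{ik})_+\big).$$ $g_Q,f_Q$ are obtained from these by replacing every $h_\delta(s)$ with $s^2$, and $g_{|\cdot|},f_{|\cdot|}$ by replacing every $h_\delta(s)$ with $|s|$. *)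

theory Defs
  imports "HOL-Analysis.Analysis"
begin

text \<open>
  A network has nodes \<open>{1..n}\<close> and an edge set \<open>E\<close> of two-element subsets of \<open>{1..n}\<close>; node \<open>i\<close> has
  a measured range to the anchors \<open>k \<in> A i\<close>, located at \<open>a k\<close>. Data attached to an edge
  (\<open>d\<close>, and the Huber radii \<open>D\<close>) are indexed by the unordered pair \<open>{i, j}\<close>. A configuration is a
  function \<open>x\<close> on \<open>nat\<close>, of which only the values on \<open>{1..n}\<close> matter.
\<close>

definition huber :: "real \<Rightarrow> real \<Rightarrow> real" where
  "huber \<delta> s = (if \<bar>s\<bar> \<le> \<delta> then s\<^sup>2 else 2 * \<delta> * \<bar>s\<bar> - \<delta>\<^sup>2)"

definition pos_part :: "real \<Rightarrow> real" where
  "pos_part s = max 0 s"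

text \<open>Each undirected edge occurs exactly once, as the pair with the smaller endpoint first.\<close>

definition edge_pairs :: "nat set set \<Rightarrow> (nat \<times> nat) set" where
  "edge_pairs E = {(i, j). i < j \<and> {i, j} \<in> E}"

text \<open>The losses \<open>\<phi>\<close> (on edges) and \<open>\<psi>\<close> (on node-anchor pairs) may vary from term to term, as the
  Huber radii do.\<close>

definition nonconvex_cost ::
  "nat \<Rightarrow> nat set set \<Rightarrow> (nat \<Rightarrow> nat set) \<Rightarrow> (nat \<Rightarrow> real ^ 'p) \<Rightarrow> (nat set \<Rightarrow> real) \<Rightarrow>
   (nat \<Rightarrow> nat \<Rightarrow> real) \<Rightarrow> (nat set \<Rightarrow> real \<Rightarrow> real) \<Rightarrow> (nat \<Rightarrow> nat \<Rightarrow> real \<Rightarrow> real) \<Rightarrow>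
   (nat \<Rightarrow> real ^ 'p) \<Rightarrow> real" where
  "nonconvex_cost n E A a d r \<phi> \<psi> x =
     (\<Sum>(i, j)\<in>edge_pairs E. 1 / 2 * \<phi> {i, j} (norm (x i - x j) - d {i, j})) +
     (\<Sum>i=1..n. \<Sum>k\<in>A i. 1 / 2 * \<psi> i k (norm (x i - a k) - r i k))"

definition convex_cost ::
  "nat \<Rightarrow> nat set set \<Rightarrow> (nat \<Rightarrow> nat set) \<Rightarrow> (nat \<Rightarrow> real ^ 'p) \<Rightarrow> (nat set \<Rightarrow> real) \<Rightarrow>
   (nat \<Rightarrow> nat \<Rightarrow> real) \<Rightarrow> (nat set \<Rightarrow> real \<Rightarrow> real) \<Rightarrow> (nat \<Rightarrow> nat \<Rightarrow> real \<Rightarrow> real) \<Rightarrow>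
   (nat \<Rightarrow> real ^ 'p) \<Rightarrow> real" where
  "convex_cost n E A a d r \<phi> \<psi> x =
     (\<Sum>(i, j)\<in>edge_pairs E. 1 / 2 * \<phi> {i, j} (pos_part (norm (x i - x j) - d {i, j}))) +
     (\<Sum>i=1..n. \<Sum>k\<in>A i. 1 / 2 * \<psi> i k (pos_part (norm (x i - a k) - r i k)))"

definition g_quad where
  "g_quad n E A a d r = nonconvex_cost n E A a d r (\<lambda>e s. s\<^sup>2) (\<lambda>i k s. s\<^sup>2)"

definition f_quad where
  "f_quad n E A a d r = convex_cost n E A a d r (\<lambda>e s. s\<^sup>2) (\<lambda>i k s. s\<^sup>2)"

definition g_abs where
  "g_abs n E A a d r = nonconvex_cost n E A a d r (\<lambda>e s. \<bar>s\<bar>) (\<lambda>i k s. \<bar>s\<bar>)"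

definition f_abs where
  "f_abs n E A a d r = convex_cost n E A a d r (\<lambda>e s. \<bar>s\<bar>) (\<lambda>i k s. \<bar>s\<bar>)"

definition g_huber where
  "g_huber n E A a d r D R =
     nonconvex_cost n E A a d r (\<lambda>e. huber (D e)) (\<lambda>i k. huber (R i k))"

definition f_huber where
  "f_huber n E A a d r D R =
     convex_cost n E A a d r (\<lambda>e. huber (D e)) (\<lambda>i k. huber (R i k))"

text \<open>The six costs above are nonnegative (for positive Huber radii), so this real infimum is genuine; it is the
  minimum whenever a minimizer exists.\<close>

definition opt_value :: "((nat \<Rightarrow> real ^ 'p) \<Rightarrow> real) \<Rightarrow> real" where
  "opt_value F = (INF x. F x)"

abbreviation is_minimizer :: "((nat \<Rightarrow> real ^ 'p) \<Rightarrow> real) \<Rightarrow> (nat \<Rightarrow> real ^ 'p) \<Rightarrow> bool" where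
  "is_minimizer F \<equiv> is_arg_min F (\<lambda>_. True)"

definition edges2 ::
  "nat set set \<Rightarrow> (nat set \<Rightarrow> real) \<Rightarrow> (nat \<Rightarrow> real ^ 'p) \<Rightarrow> (nat \<times> nat) set" where
  "edges2 E d x = {(i, j) \<in> edge_pairs E. norm (x i - x j) < d {i, j}}"

definition pairs2 ::
  "nat \<Rightarrow> (nat \<Rightarrow> nat set) \<Rightarrow> (nat \<Rightarrow> real ^ 'p) \<Rightarrow> (nat \<Rightarrow> nat \<Rightarrow> real) \<Rightarrow>
   (nat \<Rightarrow> real ^ 'p) \<Rightarrow> (nat \<times> nat) set" where
  "pairs2 n A a r x = {(i, k). i \<in> {1..n} \<and> k \<in> A i \<and> norm (x i - a k) < r i k}"

end

theory Submission
  imports Defs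
begin

text \<open>
  The convex cost composes every loss with the positive part, so it differs from the nonconvex cost
  only in the terms whose argument is negative: there the loss is replaced by its value at \<open>0\<close>, which
  is \<open>0\<close>. Hence \<open>g x - f x\<close> is, at every configuration \<open>x\<close>, exactly the sum of the losses over the
  ranges that \<open>x\<close> underestimates (lemma \<open>nonconvex_cost_eq\<close>). At a minimizer \<open>x\<close> of \<open>f\<close> the optimal
  value of \<open>f\<close> is \<open>f x\<close>, whereas that of \<open>g\<close> is at most \<open>g x\<close>; subtracting gives the bound
  (lemma \<open>optimality_gap_le\<close>). This uses of the losses only that they are nonnegative and vanish at
  \<open>0\<close>, which the quadratic, the absolute value and the Huber loss all do.
\<close>

lemma loss_split:
  fixes \<phi> :: "real \<Rightarrow> real"
  assumes "\<phi> 0 = 0"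
  shows "\<phi> s = \<phi> (pos_part s) + (if s < 0 then \<phi> s else 0)"
  using assms by (simp add: pos_part_def max_def)

lemma finite_edge_pairs:
  assumes "E \<subseteq> {e. e \<subseteq> {1..n} \<and> card e = 2}"
  shows "finite (edge_pairs E)"
  by (rule finite_subset[of _ "{1..n} \<times> {1..n}"]) (use assms in \<open>auto simp: edge_pairs_def\<close>)

lemma nonconvex_cost_eq:
  fixes x :: "nat \<Rightarrow> real ^ 'p"
  assumes fin: "finite (edge_pairs E)" "\<And>i. i \<in> {1..n} \<Longrightarrow> finite (A i)"
    and zero: "\<And>e. e \<in> E \<Longrightarrow> \<phi> e 0 = 0" "\<And>i k. i \<in> {1..n} \<Longrightarrow> k \<in> A i \<Longrightarrow> \<psi> i k 0 = 0"
  shows "nonconvex_cost n E A a d r \<phi> \<psi> x = convex_cost n E A a d r \<phi> \<psi> x +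
     ((\<Sum>(i, j)\<in>edges2 E d x. 1 / 2 * \<phi> {i, j} (norm (x i - x j) - d {i, j})) +
      (\<Sum>(i, k)\<in>pairs2 n A a r x. 1 / 2 * \<psi> i k (norm (x i - a k) - r i k)))"
proof -
  define u where "u i j = norm (x i - x j) - d {i, j}" for i j
  define v where "v i k = norm (x i - a k) - r i k" for i k
  have "(\<Sum>(i, j)\<in>edge_pairs E. 1 / 2 * \<phi> {i, j} (u i j)) =
    (\<Sum>(i, j)\<in>edge_pairs E. 1 / 2 * \<phi> {i, j} (pos_part (u i j)) +
      (if u i j < 0 then 1 / 2 * \<phi> {i, j} (u i j) else 0))"
  proof (rule sum.cong)
    fix p assume "p \<in> edge_pairs E"
    then obtain i j where p: "p = (i, j)" "{i, j} \<in> E"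
      by (auto simp: edge_pairs_def)
    then show "(case p of (i, j) \<Rightarrow> 1 / 2 * \<phi> {i, j} (u i j)) =
      (case p of (i, j) \<Rightarrow> 1 / 2 * \<phi> {i, j} (pos_part (u i j)) +
        (if u i j < 0 then 1 / 2 * \<phi> {i, j} (u i j) else 0))"
      using loss_split[of "\<phi> {i, j}" "u i j"] zero(1)[of "{i, j}"] by (simp split: if_splits)
  qed simp
  also have "\<dots> = (\<Sum>(i, j)\<in>edge_pairs E. 1 / 2 * \<phi> {i, j} (pos_part (u i j))) +
      (\<Sum>(i, j)\<in>edge_pairs E. if u i j < 0 then 1 / 2 * \<phi> {i, j} (u i j) else 0)"
    by (simp add: sum.distrib case_prod_unfold)
  also have "(\<Sum>(i, j)\<in>edge_pairs E. if u i j < 0 then 1 / 2 * \<phi> {i, j} (u i j) else 0) =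
      (\<Sum>(i, j)\<in>edges2 E d x. 1 / 2 * \<phi> {i, j} (u i j))"
    by (rule sum.mono_neutral_cong_right) (use fin in \<open>auto simp: edges2_def u_def split: if_splits\<close>)
  finally have edges: "(\<Sum>(i, j)\<in>edge_pairs E. 1 / 2 * \<phi> {i, j} (u i j)) =
      (\<Sum>(i, j)\<in>edge_pairs E. 1 / 2 * \<phi> {i, j} (pos_part (u i j))) +
      (\<Sum>(i, j)\<in>edges2 E d x. 1 / 2 * \<phi> {i, j} (u i j))" .
  have "(\<Sum>i=1..n. \<Sum>k\<in>A i. 1 / 2 * \<psi> i k (v i k)) =
    (\<Sum>i=1..n. \<Sum>k\<in>A i. 1 / 2 * \<psi> i k (pos_part (v i k)) +
      (if v i k < 0 then 1 / 2 * \<psi> i k (v i k) else 0))"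
  proof (intro sum.cong refl)
    fix i k assume "i \<in> {1..n}" "k \<in> A i"
    then show "1 / 2 * \<psi> i k (v i k) = 1 / 2 * \<psi> i k (pos_part (v i k)) +
        (if v i k < 0 then 1 / 2 * \<psi> i k (v i k) else 0)"
      using loss_split[of "\<psi> i k" "v i k"] zero(2)[of i k] by (simp split: if_splits)
  qed
  also have "\<dots> = (\<Sum>i=1..n. \<Sum>k\<in>A i. 1 / 2 * \<psi> i k (pos_part (v i k))) +
      (\<Sum>i=1..n. \<Sum>k\<in>A i. if v i k < 0 then 1 / 2 * \<psi> i k (v i k) else 0)"
    by (simp add: sum.distrib)
  also have "(\<Sum>i=1..n. \<Sum>k\<in>A i. if v i k < 0 then 1 / 2 * \<psi> i k (v i k) else 0) =
      (\<Sum>(i, k)\<in>Sigma {1..n} A. if v i k < 0 then 1 / 2 * \<psi> i k (v i k) else 0)"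
    by (rule sum.Sigma) (use fin in auto)
  also have "\<dots> = (\<Sum>(i, k)\<in>pairs2 n A a r x. 1 / 2 * \<psi> i k (v i k))"
    by (rule sum.mono_neutral_cong_right) (use fin in \<open>auto simp: pairs2_def v_def split: if_splits\<close>)
  finally show ?thesis
    using edges by (simp add: nonconvex_cost_def convex_cost_def u_def v_def)
qed

lemma opt_value_minimizer:
  assumes "is_minimizer F x"
  shows "opt_value F = F x"
  unfolding opt_value_def
  by (rule cInf_eq_minimum) (use assms in \<open>auto simp: is_arg_min_linorder\<close>)

lemma nonconvex_cost_nonneg:
  assumes "\<And>e s. e \<in> E \<Longrightarrow> \<phi> e s \<ge> 0"
    and "\<And>i k s. i \<in> {1..n} \<Longrightarrow> k \<in> A i \<Longrightarrow> \<psi> i k s \<ge> 0"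
  shows "nonconvex_cost n E A a d r \<phi> \<psi> x \<ge> 0"
  unfolding nonconvex_cost_def
  by (intro add_nonneg_nonneg sum_nonneg) (use assms in \<open>auto simp: edge_pairs_def\<close>)

text \<open>Nonnegativity of the losses bounds \<open>g\<close> below, without which its real infimum would be an
  unspecified number and not a lower bound for \<open>g x\<close>.\<close>

lemma optimality_gap_le:
  fixes x :: "nat \<Rightarrow> real ^ 'p"
  assumes "finite (edge_pairs E)" "\<And>i. i \<in> {1..n} \<Longrightarrow> finite (A i)"
    and "\<And>e. e \<in> E \<Longrightarrow> \<phi> e 0 = 0" "\<And>i k. i \<in> {1..n} \<Longrightarrow> k \<in> A i \<Longrightarrow> \<psi> i k 0 = 0"
    and nonneg: "\<And>e s. e \<in> E \<Longrightarrow> \<phi> e s \<ge> 0"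
      "\<And>i k s. i \<in> {1..n} \<Longrightarrow> k \<in> A i \<Longrightarrow> \<psi> i k s \<ge> 0"
    and min: "is_minimizer (convex_cost n E A a d r \<phi> \<psi>) x"
  shows "opt_value (nonconvex_cost n E A a d r \<phi> \<psi>) - opt_value (convex_cost n E A a d r \<phi> \<psi>)
     \<le> (\<Sum>(i, j)\<in>edges2 E d x. 1 / 2 * \<phi> {i, j} (norm (x i - x j) - d {i, j})) +
       (\<Sum>(i, k)\<in>pairs2 n A a r x. 1 / 2 * \<psi> i k (norm (x i - a k) - r i k))"
proof -
  have "bdd_below (range (nonconvex_cost n E A a d r \<phi> \<psi>))"
    by (rule bdd_belowI[of _ 0]) (use nonneg in \<open>auto intro!: nonconvex_cost_nonneg\<close>)
  then have "opt_value (nonconvex_cost n E A a d r \<phi> \<psi>) \<le> nonconvex_cost n E A a d r \<phi> \<psi> x"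
    unfolding opt_value_def by (rule cINF_lower) simp
  also have "\<dots> = convex_cost n E A a d r \<phi> \<psi> x +
     ((\<Sum>(i, j)\<in>edges2 E d x. 1 / 2 * \<phi> {i, j} (norm (x i - x j) - d {i, j})) +
      (\<Sum>(i, k)\<in>pairs2 n A a r x. 1 / 2 * \<psi> i k (norm (x i - a k) - r i k)))"
    by (rule nonconvex_cost_eq) (use assms in auto)
  finally show ?thesis
    using opt_value_minimizer[OF min] by linarith
qed

lemma huber_zero: "\<delta> \<ge> 0 \<Longrightarrow> huber \<delta> 0 = 0"
  by (simp add: huber_def)

lemma huber_nonneg:
  assumes "\<delta> \<ge> 0"
  shows "huber \<delta> s \<ge> 0"
proof (cases "\<bar>s\<bar> \<le> \<delta>")
  case False
  then have "\<delta> * \<delta> \<le> 2 * \<delta> * \<bar>s\<bar>"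
    using assms mult_left_mono[of \<delta> "2 * \<bar>s\<bar>" \<delta>] by (simp add: mult_ac)
  with False show ?thesis
    by (simp add: huber_def power2_eq_square)
qed (simp add: huber_def)

theorem mainTheorem5:
  fixes n m :: nat
    and E :: "nat set set"
    and A :: "nat \<Rightarrow> nat set"
    and a :: "nat \<Rightarrow> real ^ 'p"
    and d D :: "nat set \<Rightarrow> real"
    and r R :: "nat \<Rightarrow> nat \<Rightarrow> real"
  assumes "CARD('p) = 2 \<or> CARD('p) = 3"
    and "E \<subseteq> {e. e \<subseteq> {1..n} \<and> card e = 2}"
    and "\<forall>i\<in>{1..n}. A i \<subseteq> {1..m}"
    and "\<forall>e\<in>E. d e \<ge> 0"
    and "\<forall>i\<in>{1..n}. \<forall>k\<in>A i. r i k \<ge> 0"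
    and "\<forall>e\<in>E. D e > 0"
    and "\<forall>i\<in>{1..n}. \<forall>k\<in>A i. R i k > 0"
  shows
    "(\<forall>x. is_minimizer (f_quad n E A a d r) x \<longrightarrow>
        opt_value (g_quad n E A a d r) - opt_value (f_quad n E A a d r)
        \<le> (\<Sum>(i, j)\<in>edges2 E d x. 1 / 2 * (norm (x i - x j) - d {i, j})\<^sup>2)
          + (\<Sum>(i, k)\<in>pairs2 n A a r x. 1 / 2 * (norm (x i - a k) - r i k)\<^sup>2))
   \<and> (\<forall>x. is_minimizer (f_abs n E A a d r) x \<longrightarrow>
        opt_value (g_abs n E A a d r) - opt_value (f_abs n E A a d r)
        \<le> (\<Sum>(i, j)\<in>edges2 E d x. 1 / 2 * \<bar>norm (x i - x j) - d {i, j}\<bar>)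
          + (\<Sum>(i, k)\<in>pairs2 n A a r x. 1 / 2 * \<bar>norm (x i - a k) - r i k\<bar>))
   \<and> (\<forall>x. is_minimizer (f_huber n E A a d r D R) x \<longrightarrow>
        opt_value (g_huber n E A a d r D R) - opt_value (f_huber n E A a d r D R)
        \<le> (\<Sum>(i, j)\<in>edges2 E d x. 1 / 2 * huber (D {i, j}) (norm (x i - x j) - d {i, j}))
          + (\<Sum>(i, k)\<in>pairs2 n A a r x. 1 / 2 * huber (R i k) (norm (x i - a k) - r i k)))"
proof -
  have fin: "finite (edge_pairs E)" "\<And>i. i \<in> {1..n} \<Longrightarrow> finite (A i)"
    using finite_edge_pairs[OF assms(2)] assms(3) by (blast intro: finite_subset[OF _ finite_atLeastAtMost])+
  show ?thesis
    unfolding g_quad_def f_quad_def g_abs_def f_abs_def g_huber_def f_huber_def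
    by (intro conjI allI impI; rule optimality_gap_le)
      (use fin assms(6,7) in \<open>auto simp: less_imp_le huber_zero huber_nonneg\<close>)
qed

end
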